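(* Let $n\ge k\ge 1$ be integers and let $\mathsf{U}_{k,n}$ be the uniform geometric lattice of rank $k$ on $n$ elements. Then every zero of the Chow polynomial $\underline{H}_{\mathsf{U}_{k,n}}(t)$ is real.
   Context: All posets are finite, bounded (least element $\widehat 0$, greatest element $\widehat 1$) and graded with rank function $\rho$, $\rho(\widehat 0)=0$; $\rho(P):=\rho(\widehat 1)$. The Boolean algebra $\mathsf{B}_n$ is the power set of $\{1,\dots,n\}$ ordered by inclusion. The truncation $\tau(P)$ of $P$ is the poset obtained from $P$ by removing all coatoms (elements of rank $\rho(P)-1$). The uniform geometric lattice is $\mathsf{U}_{k,n}:=\tau^{n-k}(\mathsf{B}_n)$ (truncate $n-k$ times). Chow polynomial: let $\mu$ be the Möbius function of $P$. For $x\le y$ put $\chi_{[x,y]}(t)=\sum_{x\le z\le y}\mu(x,z)t^{\rho(y)-\rho(z)}$, and define $\overline{\chi}_{[x,x]}(t)=-1$ and $\overline{\chi}_{[x,y]}(t)=\chi_{[x,y]}(t)/(t-1)$ for $x<y$ (this is a polynomial). Define $\underline{H}_{[x,x]}(t)=1$ and, for $x<y$, recursively $\underline{H}_{[x,y]}(t)=\sum_{x<z\le y}\overline{\chi}_{[x,z]}(t)\,\underline{H}_{[z,y]}(t)$ (equivalently $\underline{H}$ is the inverse of $-\overline\chi$ in the incidence algebra). The Chow polynomial of $P$ is $\underline{H}_P(t):=\underline{H}_{[\widehat0,\widehat1]}(t)$. *)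

theory Defs
  imports Complex_Main "HOL-Computational_Algebra.Polynomial"
begin

text \<open>
  A poset is a set \<open>P\<close> of elements of an ordered type, with the order restricted to \<open>P\<close>;
  its least and greatest elements are \<open>LEAST x. x \<in> P\<close> and \<open>GREATEST x. x \<in> P\<close>.
\<close>

definition covers_in :: "'a::order set \<Rightarrow> 'a \<Rightarrow> 'a \<Rightarrow> bool" where
  "covers_in P x y \<longleftrightarrow> x \<in> P \<and> y \<in> P \<and> x < y \<and> \<not> (\<exists>z\<in>P. x < z \<and> z < y)"

text \<open>The value \<open>0\<close> outside \<open>P\<close> is a convention that makes the rank function unique.\<close>

definition is_rank_function :: "'a::order set \<Rightarrow> ('a \<Rightarrow> nat) \<Rightarrow> bool" where
  "is_rank_function P r \<longleftrightarrow>
     r (LEAST x. x \<in> P) = 0 \<and>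
     (\<forall>x y. covers_in P x y \<longrightarrow> r y = r x + 1) \<and>
     (\<forall>x. x \<notin> P \<longrightarrow> r x = 0)"

definition bounded_graded_poset :: "'a::order set \<Rightarrow> bool" where
  "bounded_graded_poset P \<longleftrightarrow>
     finite P \<and> (\<exists>x\<in>P. \<forall>y\<in>P. x \<le> y) \<and> (\<exists>x\<in>P. \<forall>y\<in>P. y \<le> x) \<and>
     (\<exists>r. is_rank_function P r)"

definition rank_in :: "'a::order set \<Rightarrow> 'a \<Rightarrow> nat" where
  "rank_in P = (THE r. is_rank_function P r)"

definition poset_rank :: "'a::order set \<Rightarrow> nat" where
  "poset_rank P = rank_in P (GREATEST x. x \<in> P)"

text \<open>
  The recursions below are guarded by \<open>finite P\<close> and by membership in \<open>P\<close>, as needed for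
  termination.
\<close>

function moebius :: "'a::order set \<Rightarrow> 'a \<Rightarrow> 'a \<Rightarrow> int" where
  "moebius P x y =
     (if finite P \<and> x \<in> P \<and> y \<in> P \<and> x \<le> y
      then if x = y then 1 else - (\<Sum>z\<in>{z\<in>P. x \<le> z \<and> z < y}. moebius P x z)
      else 0)"
  by pat_completeness auto
termination
  by (relation "measure (\<lambda>(P, x, y). card {z\<in>P. z < y})")
     (auto intro!: psubset_card_mono)

declare moebius.simps [simp del]

definition char_poly_in :: "'a::order set \<Rightarrow> 'a \<Rightarrow> 'a \<Rightarrow> int poly" where
  "char_poly_in P x y =
     (\<Sum>z\<in>{z\<in>P. x \<le> z \<and> z \<le> y}. monom (moebius P x z) (rank_in P y - rank_in P z))"

text \<open>The division by \<open>t - 1\<close> is exact: see \<open>red_char_poly_in_mult\<close> below.\<close>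

definition red_char_poly_in :: "'a::order set \<Rightarrow> 'a \<Rightarrow> 'a \<Rightarrow> int poly" where
  "red_char_poly_in P x y = (if x = y then - 1 else char_poly_in P x y div [:- 1, 1:])"

function chow_poly_in :: "'a::order set \<Rightarrow> 'a \<Rightarrow> 'a \<Rightarrow> int poly" where
  "chow_poly_in P x y =
     (if finite P \<and> x \<in> P \<and> y \<in> P \<and> x \<le> y
      then if x = y then 1
           else (\<Sum>z\<in>{z\<in>P. x < z \<and> z \<le> y}. red_char_poly_in P x z * chow_poly_in P z y)
      else 0)"
  by pat_completeness auto
termination
  by (relation "measure (\<lambda>(P, x, y). card {z\<in>P. x < z})")
     (auto intro!: psubset_card_mono)

declare chow_poly_in.simps [simp del]

definition chow_poly :: "'a::order set \<Rightarrow> int poly" where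
  "chow_poly P = chow_poly_in P (LEAST x. x \<in> P) (GREATEST x. x \<in> P)"

text \<open>The coatoms are the elements of rank one less than the rank of the poset.\<close>

definition truncation :: "'a::order set \<Rightarrow> 'a set" where
  "truncation P = {x\<in>P. rank_in P x + 1 \<noteq> poset_rank P}"

definition boolean_algebra_poset :: "nat \<Rightarrow> nat set set" where
  "boolean_algebra_poset n = Pow {1..n}"

definition uniform_lattice :: "nat \<Rightarrow> nat \<Rightarrow> nat set set" where
  "uniform_lattice k n = (truncation ^^ (n - k)) (boolean_algebra_poset n)"


lemma Least_in_eqI:
  "x \<in> P \<Longrightarrow> (\<And>y. y \<in> P \<Longrightarrow> x \<le> y) \<Longrightarrow> (LEAST x. x \<in> P) = (x::'a::order)"
  by (rule Least_equality)

lemma Greatest_in_eqI: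
  "x \<in> P \<Longrightarrow> (\<And>y. y \<in> P \<Longrightarrow> y \<le> x) \<Longrightarrow> (GREATEST x. x \<in> P) = (x::'a::order)"
  by (rule Greatest_equality)

lemma rank_function_unique:
  fixes P :: "'a::order set"
  assumes fin: "finite P" and least: "b \<in> P" "\<And>y. y \<in> P \<Longrightarrow> b \<le> y"
    and r: "is_rank_function P r" and s: "is_rank_function P s"
  shows "r = s"
proof
  have b: "(LEAST x. x \<in> P) = b"
    using least by (rule Least_in_eqI)
  fix x show "r x = s x"
  proof (induction "card {z\<in>P. z < x}" arbitrary: x rule: less_induct)
    case less
    show ?case
    proof (cases "x \<in> P \<and> x \<noteq> b")
      case False
      then show ?thesis using r s b unfolding is_rank_function_def by metis
    next
      case True
      let ?A = "{z\<in>P. z < x}"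
      have "finite ?A" "b \<in> ?A"
        using fin least True by (auto simp: order.strict_iff_order)
      then obtain m where m: "m \<in> ?A" "\<And>z. z \<in> ?A \<Longrightarrow> m \<le> z \<Longrightarrow> m = z"
        using finite_has_maximal[of ?A] by blast
      have cov: "covers_in P m x"
        unfolding covers_in_def using m True by (auto dest: less_imp_le)
      have "{z\<in>P. z < m} \<subset> ?A" using m by auto
      then have "card {z\<in>P. z < m} < card ?A"
        using fin by (intro psubset_card_mono) auto
      then have "r m = s m" by (rule less)
      with cov r s show ?thesis unfolding is_rank_function_def by metis
    qed
  qed
qed

lemma rank_in_eqI:
  assumes "finite P" "b \<in> P" "\<And>y. y \<in> P \<Longrightarrow> b \<le> y" "is_rank_function P r"
  shows "rank_in P = r"
  unfolding rank_in_def using assms rank_function_unique[OF assms(1-3)] by (intro the_equality) auto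

lemma sum_moebius:
  assumes "finite P" "x \<in> P" "y \<in> P" "x < y"
  shows "(\<Sum>z\<in>{z\<in>P. x \<le> z \<and> z \<le> y}. moebius P x z) = 0"
proof -
  have "{z\<in>P. x \<le> z \<and> z \<le> y} = insert y {z\<in>P. x \<le> z \<and> z < y}"
    using assms by (auto simp: order.order_iff_strict)
  then show ?thesis
    using assms moebius.simps[of P x y] by auto
qed

lemma red_char_poly_in_mult:
  assumes "finite P" "x \<in> P" "y \<in> P" "x < y"
  shows "[:- 1, 1:] * red_char_poly_in P x y = char_poly_in P x y"
proof -
  have "poly (char_poly_in P x y) 1 = 0"
    using sum_moebius[OF assms] by (simp add: char_poly_in_def poly_sum poly_monom)
  then have "[:- 1, 1:] dvd char_poly_in P x y"
    by (simp add: poly_eq_0_iff_dvd)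
  then have "[:- 1, 1:] * (char_poly_in P x y div [:- 1, 1:]) = char_poly_in P x y"
    by (rule dvd_mult_div_cancel)
  then show ?thesis using assms unfolding red_char_poly_in_def by auto
qed

definition uniform_rank :: "nat \<Rightarrow> nat \<Rightarrow> nat set \<Rightarrow> nat" where
  "uniform_rank k n S = (if S = {1..n} then k else if S \<subseteq> {1..n} \<and> card S < k then card S else 0)"

lemma is_rank_function_uniform:
  assumes "1 \<le> k" "k \<le> n"
  shows "is_rank_function (insert {1..n} {S. S \<subseteq> {1..n} \<and> card S < k}) (uniform_rank k n)"
    (is "is_rank_function ?P _")
proof -
  have least: "(LEAST x. x \<in> ?P) = {}"
    using assms by (intro Least_in_eqI) auto
  have fin: "finite S" if "S \<in> ?P" for S
    using that finite_subset[of S "{1..n}"] by auto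
  have "uniform_rank k n T = uniform_rank k n S + 1" if cov: "covers_in ?P S T" for S T
  proof -
    have ST: "S \<in> ?P" "T \<in> ?P" "S \<subset> T"
      and no: "\<And>Z. Z \<in> ?P \<Longrightarrow> S \<subset> Z \<Longrightarrow> Z \<subset> T \<Longrightarrow> False"
      using cov unfolding covers_in_def by blast+
    have Tn: "T \<subseteq> {1..n}" using ST by auto
    have Sn: "S \<noteq> {1..n}" using ST Tn by auto
    have Sk: "S \<subseteq> {1..n}" "card S < k" using ST Sn by auto
    obtain a where a: "a \<in> T" "a \<notin> S" using ST by auto
    have ca: "card (insert a S) = card S + 1" using a fin ST by simp
    show ?thesis
    proof (cases "card S + 1 < k")
      case True
      then have "insert a S \<in> ?P" using Sk a Tn ca by auto
      then have T: "T = insert a S" using no[of "insert a S"] a ST by blast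
      then have "T \<noteq> {1..n}" using True ca assms by auto
      with T Sn Sk True ca Tn show ?thesis by (simp add: uniform_rank_def)
    next
      case False
      then have k: "k = card S + 1" using Sk by simp
      have "card S < card T" by (rule psubset_card_mono[OF fin[OF ST(2)] ST(3)])
      then have "T = {1..n}" using ST(2) k by simp
      with Sn Sk k show ?thesis by (simp add: uniform_rank_def)
    qed
  qed
  moreover have "uniform_rank k n {} = 0"
    using assms by (auto simp: uniform_rank_def)
  ultimately show ?thesis
    unfolding is_rank_function_def least by (auto simp: uniform_rank_def)
qed

lemma uniform_explicit:
  assumes "1 \<le> k" "k \<le> n"
  defines "P \<equiv> insert {1..n} {S. S \<subseteq> {1..n} \<and> card S < k}"
  shows "rank_in P = uniform_rank k n" "poset_rank P = k" "bounded_graded_poset P"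
proof -
  have fin: "finite P" unfolding P_def by (rule finite_subset[of _ "Pow {1..n}"]) auto
  have l: "{} \<in> P" using assms by (simp add: P_def)
  have rf: "is_rank_function P (uniform_rank k n)"
    unfolding P_def using assms by (intro is_rank_function_uniform)
  show 1: "rank_in P = uniform_rank k n"
    by (rule rank_in_eqI[OF fin l _ rf]) auto
  have "(GREATEST x. x \<in> P) = {1..n}"
    by (rule Greatest_in_eqI) (auto simp: P_def)
  then show "poset_rank P = k" by (simp add: poset_rank_def 1 uniform_rank_def)
  have "\<exists>x\<in>P. \<forall>y\<in>P. x \<le> y" using l by auto
  moreover have "\<exists>x\<in>P. \<forall>y\<in>P. y \<le> x" by (rule bexI[of _ "{1..n}"]) (auto simp: P_def)
  ultimately show "bounded_graded_poset P"
    unfolding bounded_graded_poset_def using fin rf by blast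
qed

lemma uniform_lattice_eq:
  assumes "1 \<le> k" "k \<le> n"
  shows "uniform_lattice k n = insert {1..n} {S. S \<subseteq> {1..n} \<and> card S < k}"
proof -
  have "uniform_lattice (n - j) n = insert {1..n} {S. S \<subseteq> {1..n} \<and> card S < n - j}"
    if "j < n" for j
    using that
  proof (induction j)
    case 0
    have "S = {1..n}" if "S \<subseteq> {1..n}" "\<not> card S < n" for S
      using that card_seteq[of "{1..n}" S] by auto
    then show ?case by (auto simp: uniform_lattice_def boolean_algebra_poset_def)
  next
    case (Suc j)
    define k where "k = n - Suc j"
    have k: "1 \<le> k" "Suc k \<le> n" "n - j = Suc k" "n - k = Suc j" "n - Suc k = j"
      using Suc.prems by (auto simp: k_def)
    let ?P = "insert {1..n} {S. S \<subseteq> {1..n} \<and> card S < Suc k}"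
    have IH: "uniform_lattice (Suc k) n = ?P" using Suc k by simp
    have "uniform_lattice k n = truncation (uniform_lattice (Suc k) n)"
      by (simp add: uniform_lattice_def k)
    also have "\<dots> = insert {1..n} {S. S \<subseteq> {1..n} \<and> card S < k}"
      unfolding IH truncation_def using uniform_explicit[of "Suc k" n] k
      by (auto simp: uniform_rank_def)
    finally show ?case by (simp add: k_def)
  qed
  from this[of "n - k"] assms show ?thesis by simp
qed

lemma bounded_graded_poset_uniform_lattice:
  assumes "1 \<le> k" "k \<le> n"
  shows "bounded_graded_poset (uniform_lattice k n)" "poset_rank (uniform_lattice k n) = k"
  using uniform_explicit[OF assms] uniform_lattice_eq[OF assms] by auto

end

theory Submission
  imports Defs "HOL-Computational_Algebra.Formal_Power_Series"
begin

text \<open>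
  Let \<open>d\<^sub>m(t)\<close> be the derangement polynomials, with exponential generating function
  \<open>(t - 1) / (t e\<^sup>x - e\<^sup>t\<^sup>x)\<close>. The Chow polynomial of the uniform lattice of rank \<open>k\<close> on \<open>n\<close> elements
  is \<open>\<Sum>m<k. (n choose m) d\<^sub>m (1 + t + \<dots> + t\<^bsup>k-1-m\<^esup>)\<close>. Neville elimination on the rows of Pascal's
  triangle rewrites it as a nonnegative combination of palindromic polynomials \<open>g\<^sub>0, \<dots>, g\<^bsub>k-1\<^esub>\<close> that do
  not depend on \<open>n\<close> and satisfy a subtraction-free recursion in \<open>k\<close>.

  In the variable \<open>s = t / (1 + t)\<^sup>2\<close> this recursion preserves interlacing. Interlacing is used in
  the following pointwise form: at every \<open>s\<close> of the upper half plane, the quotient of the two values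
  lies in the convex cone spanned by \<open>1\<close> and \<open>s\<close>. Hence a nonnegative combination of the \<open>g\<^sub>j\<close> with
  \<open>g\<^sub>0\<close> present cannot vanish there. For real \<open>s\<close> and nonreal \<open>t\<close> one has \<open>s > 0\<close>, where all
  summands are nonnegative.
\<close>

section \<open>Interlacing at a point of the upper half plane\<close>

text \<open>For \<open>u \<noteq> 0\<close> and \<open>s\<close> in the upper half plane this says that \<open>v / u\<close> lies in the cone spanned by
  \<open>1\<close> and \<open>s\<close>. The relation is not transitive.\<close>

definition sector_le :: "complex \<Rightarrow> complex \<Rightarrow> complex \<Rightarrow> bool" where
  "sector_le s u v \<longleftrightarrow> 0 \<le> Im (v * cnj u) \<and> 0 \<le> Im (s * u * cnj v)"

lemma sector_le_refl: "0 \<le> Im s \<Longrightarrow> sector_le s u u"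
  by (simp add: sector_le_def mult.assoc flip: complex_norm_square)

lemma sector_le_zero [simp]: "sector_le s 0 v" "sector_le s u 0"
  by (auto simp: sector_le_def)

lemma sector_le_add_left: "sector_le s u w \<Longrightarrow> sector_le s v w \<Longrightarrow> sector_le s (u + v) w"
  by (simp add: sector_le_def algebra_simps)

lemma sector_le_add_right: "sector_le s u v \<Longrightarrow> sector_le s u w \<Longrightarrow> sector_le s u (v + w)"
  by (simp add: sector_le_def algebra_simps)

lemma sector_le_sum_left:
  "(\<And>i. i \<in> A \<Longrightarrow> sector_le s (f i) w) \<Longrightarrow> sector_le s (\<Sum>i\<in>A. f i) w"
  by (induction A rule: infinite_finite_induct) (auto intro: sector_le_add_left)

lemma sector_le_sum_right:
  "(\<And>i. i \<in> A \<Longrightarrow> sector_le s u (f i)) \<Longrightarrow> sector_le s u (\<Sum>i\<in>A. f i)"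
  by (induction A rule: infinite_finite_induct) (auto intro: sector_le_add_right)

lemma sector_le_scale_right:
  assumes "0 \<le> r" "sector_le s u v"
  shows "sector_le s u (of_real r * v)"
proof -
  have "Im (of_real r * v * cnj u) = r * Im (v * cnj u)"
    "Im (s * u * cnj (of_real r * v)) = r * Im (s * u * cnj v)"
    by (simp_all add: algebra_simps)
  with assms show ?thesis by (simp add: sector_le_def)
qed

lemma mult_cnj_mult: "(s * u) * cnj (s * v) = of_real ((norm s)\<^sup>2) * (u * cnj v)"
  unfolding complex_norm_square by (simp add: mult_ac)

lemma Im_of_real_mult: "Im (of_real r * u) = r * Im u"
  by simp

lemma sector_le_cancel:
  assumes "s \<noteq> 0"
  shows "sector_le s (s * u) (s * v) \<longleftrightarrow> sector_le s u v"
  using assms unfolding sector_le_def mult_cnj_mult Im_of_real_mult by (simp only: zero_le_mult_iff) auto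

text \<open>The second condition for \<open>u\<close>, \<open>v\<close> is the first one for
  \<open>v\<close>, \<open>s * u\<close>. Conversely the factor \<open>s\<close> occurs in both
  entries of \<open>(s * v) * cnj (s * u)\<close> and leaves only the positive scale
  \<open>(norm s)\<^sup>2\<close> or zero.\<close>

lemma sector_le_rotate:
  assumes "sector_le s u v"
  shows "sector_le s v (s * u)"
  using assms unfolding sector_le_def mult.assoc[of s v] mult_cnj_mult Im_of_real_mult by simp

text \<open>Additivity in both arguments reduces the claim to pairs of single indices, except on the
  overlap \<open>{c..<b}\<close>, where pairs occur in the wrong order. There the whole block is
  compared with itself by reflexivity.\<close>

lemma sector_le_sum_intervals:
  fixes f :: "nat \<Rightarrow> complex"
  assumes s: "0 \<le> Im s"
    and f: "\<And>i j. i \<le> j \<Longrightarrow> j < N \<Longrightarrow> sector_le s (f i) (f j)"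
    and "a \<le> c" "b \<le> d" "d \<le> N"
  shows "sector_le s (\<Sum>i=a..<b. f i) (\<Sum>i=c..<d. f i)"
proof (cases "a \<le> b \<and> c \<le> b")
  case False
  then have "{a..<b} = {} \<or> b \<le> c" by auto
  then show ?thesis
    using assms(3-) by (auto intro!: sector_le_sum_left sector_le_sum_right f)
next
  case True
  have 1: "(\<Sum>i=a..<b. f i) = (\<Sum>i=a..<c. f i) + (\<Sum>i=c..<b. f i)"
    using True assms by (simp add: sum.atLeastLessThan_concat)
  have 2: "(\<Sum>i=c..<d. f i) = (\<Sum>i=c..<b. f i) + (\<Sum>i=b..<d. f i)"
    using True assms by (simp add: sum.atLeastLessThan_concat)
  show ?thesis
    unfolding 1 2 using assms(3-) True
    by (intro sector_le_add_left sector_le_add_right sector_le_refl s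
        sector_le_sum_left sector_le_sum_right f) auto
qed

section \<open>The recursion in the variable s and its preservation of interlacing\<close>

locale gamma_recursion =
  fixes s :: complex and G C :: "nat \<Rightarrow> nat \<Rightarrow> complex"
  assumes G_0: "G 0 0 = 1" and C_0: "C 0 0 = 0"
    and C_Suc: "\<And>K j. j \<le> Suc K \<Longrightarrow> C (Suc K) j = (\<Sum>i=j..<Suc K. G K i)"
    and G_Suc: "\<And>K j. j \<le> Suc K \<Longrightarrow>
      G (Suc K) j = (\<Sum>i=j..<Suc K. G K i) + s * (\<Sum>i=0..<j. C K i)"
begin

text \<open>The third conjunct, with intervals instead of single indices, is what makes the induction work
  without any appeal to transitivity.\<close>

lemma interlacing:
  assumes s: "0 < Im s"
  shows "(\<forall>i j. i \<le> j \<longrightarrow> j \<le> K \<longrightarrow> sector_le s (G K i) (G K j)) \<and>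
    (\<forall>i j. i \<le> j \<longrightarrow> j \<le> K \<longrightarrow> sector_le s (C K i) (C K j)) \<and>
    (\<forall>a b c d. a \<le> c \<longrightarrow> b \<le> d \<longrightarrow> d \<le> Suc K \<longrightarrow>
       sector_le s (\<Sum>i=a..<b. C K i) (\<Sum>i=c..<d. G K i))"
proof (induction K)
  case 0
  have "(\<Sum>i=a..<b. C 0 i) = 0" if "b \<le> Suc 0" for a b
  proof (intro sum.neutral ballI)
    fix x assume "x \<in> {a..<b}"
    then have "x = 0" using that by auto
    then show "C 0 x = 0" using C_0 by simp
  qed
  then show ?case using s by (auto simp: sector_le_refl)
next
  case (Suc K)
  have s0: "0 \<le> Im s" "s \<noteq> 0" using s by auto
  have GG: "sector_le s (G K i) (G K j)" if "i \<le> j" "j < Suc K" for i j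
    using Suc.IH that by auto
  have CC: "sector_le s (C K i) (C K j)" if "i \<le> j" "j < Suc K" for i j
    using Suc.IH that by auto
  have CG: "sector_le s (\<Sum>i=a..<b. C K i) (\<Sum>i=c..<d. G K i)"
    if "a \<le> c" "b \<le> d" "d \<le> Suc K" for a b c d
    using Suc.IH that by blast
  define P where "P j = (\<Sum>i=j..<Suc K. G K i)" for j
  define Q where "Q j = (\<Sum>i=0..<j. C K i)" for j
  have CP: "C (Suc K) j = P j" if "j < Suc (Suc K)" for j
    using that C_Suc[of j K] by (simp add: P_def)
  have GP: "G (Suc K) j = P j + s * Q j" if "j < Suc (Suc K)" for j
    using that G_Suc[of j K] by (simp add: P_def Q_def)
  have PP: "sector_le s (P i) (P j)" if "i \<le> j" for i j
    unfolding P_def by (rule sector_le_sum_intervals[OF s0(1) GG]) (use that in auto)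
  have QP: "sector_le s (Q i) (P j)" if "i \<le> Suc K" for i j
    unfolding P_def Q_def by (rule CG) (use that in auto)
  have I: "sector_le s (G (Suc K) j) (G (Suc K) l)" if jl: "j \<le> l" "l \<le> Suc K" for j l
  proof -
    \<comment> \<open>From \<open>j\<close> to \<open>l\<close> the tail sum loses the block
      \<open>b\<close> and the head sum gains the block \<open>e\<close>. So the two values are
      \<open>b + m\<close> and \<open>m + s * e\<close> with the common part
      \<open>m = P l + s * Q j\<close>, and reflexivity at \<open>m\<close> takes the place of
      transitivity.\<close>
    define b e where "b = (\<Sum>i=j..<l. G K i)" and "e = (\<Sum>i=j..<l. C K i)"
    have Pj: "P j = b + P l"
      unfolding P_def b_def using jl by (simp add: sum.atLeastLessThan_concat del: sum.op_ivl_Suc)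
    have Ql: "Q l = Q j + e"
      unfolding Q_def e_def using jl by (simp add: sum.atLeastLessThan_concat)
    have "sector_le s b (P l)"
      unfolding b_def P_def by (rule sector_le_sum_intervals[OF s0(1) GG]) (use jl in auto)
    moreover have "sector_le s b (s * Q j)"
      unfolding b_def Q_def by (rule sector_le_rotate, rule CG) (use jl in auto)
    moreover have "sector_le s b (s * e)"
      unfolding b_def e_def by (rule sector_le_rotate, rule CG) (use jl in auto)
    moreover have "sector_le s (P l) (s * e)"
      unfolding P_def e_def by (rule sector_le_rotate, rule CG) (use jl in auto)
    moreover have "sector_le s (s * Q j) (s * e)"
      unfolding Q_def e_def sector_le_cancel[OF s0(2)]
      by (rule sector_le_sum_intervals[OF s0(1) CC]) (use jl in auto)
    ultimately have *: "sector_le s b (P l)" "sector_le s b (s * Q j)" "sector_le s b (s * e)"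
      "sector_le s (P l) (s * e)" "sector_le s (s * Q j) (s * e)" by simp_all
    have "sector_le s b ((P l + s * Q j) + s * e)"
      by (intro sector_le_add_right *)
    moreover have "sector_le s (P l + s * Q j) ((P l + s * Q j) + s * e)"
      by (rule sector_le_add_right[OF sector_le_refl[OF s0(1)] sector_le_add_left[OF *(4,5)]])
    ultimately have "sector_le s (b + (P l + s * Q j)) ((P l + s * Q j) + s * e)"
      by (rule sector_le_add_left)
    then show ?thesis using jl by (simp add: GP Pj Ql algebra_simps)
  qed
  have M: "sector_le s (\<Sum>i=a..<b. C (Suc K) i) (\<Sum>i=c..<d. G (Suc K) i)"
    if "a \<le> c" "b \<le> d" "d \<le> Suc (Suc K)" for a b c d
  proof -
    have 1: "(\<Sum>i=a..<b. C (Suc K) i) = (\<Sum>i=a..<b. P i)"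
      using that by (intro sum.cong CP) auto
    have 2: "(\<Sum>i=c..<d. G (Suc K) i) = (\<Sum>i=c..<d. P i) + (\<Sum>i=c..<d. s * Q i)"
      unfolding sum.distrib[symmetric] using that by (intro sum.cong GP) auto
    show ?thesis
      unfolding 1 2
    proof (rule sector_le_add_right)
      show "sector_le s (\<Sum>i=a..<b. P i) (\<Sum>i=c..<d. P i)"
        by (rule sector_le_sum_intervals[OF s0(1) PP]) (use that in auto)
      show "sector_le s (\<Sum>i=a..<b. P i) (\<Sum>i=c..<d. s * Q i)"
        using that by (intro sector_le_sum_left sector_le_sum_right sector_le_rotate QP) auto
    qed
  qed
  show ?case using I M PP CP by auto
qed

text \<open>If the sum vanished, the terms with \<open>j > 0\<close> would add up to a negative
  multiple of \<open>G K 0\<close>. Interlacing puts their quotient by \<open>G K 0\<close> into the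
  cone spanned by 1 and \<open>s\<close>, which contains no negative real number.\<close>

lemma weighted_sum_nonzero_upper:
  fixes w :: "nat \<Rightarrow> real"
  assumes s: "0 < Im s" and w: "0 < w 0" "\<And>j. 0 \<le> w j"
  shows "(\<Sum>j=0..<Suc K. of_real (w j) * G K j) \<noteq> 0"
proof -
  have *: "(\<Sum>j=0..<Suc K. of_real (w j) * G K j) \<noteq> 0"
    if G0: "G K 0 \<noteq> 0" and w: "0 < w 0" "\<And>j. 0 \<le> w j" for K and w :: "nat \<Rightarrow> real"
  proof
    define R where "R = (\<Sum>j=Suc 0..<Suc K. of_real (w j) * G K j)"
    have "sector_le s (G K 0) R"
      unfolding R_def using interlacing[OF s, of K] w
      by (intro sector_le_sum_right sector_le_scale_right) auto
    then have "0 \<le> Im (s * G K 0 * cnj R)" by (simp add: sector_le_def)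
    moreover assume "(\<Sum>j=0..<Suc K. of_real (w j) * G K j) = 0"
    then have "R = - of_real (w 0) * G K 0"
      by (simp add: sum.atLeast_Suc_lessThan R_def add_eq_0_iff2 del: sum.op_ivl_Suc)
    then have "s * G K 0 * cnj R = of_real (- w 0 * (norm (G K 0))\<^sup>2) * s"
      by (simp add: complex_norm_square algebra_simps del: of_real_power)
    moreover have "Im (of_real (- w 0 * (norm (G K 0))\<^sup>2) * s) < 0"
      using s w G0 by (simp del: of_real_mult of_real_minus of_real_power)
    ultimately show False by simp
  qed
  \<comment> \<open>By the recursion, \<open>G (Suc K) 0\<close> is the sum of all
    \<open>G K i\<close>, which is the weighted sum with all weights 1.\<close>
  have "G K 0 \<noteq> 0"
  proof (induction K)
    case (Suc K)
    then show ?case using *[of K "\<lambda>_. 1"] by (simp add: G_Suc)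
  qed (simp add: G_0)
  then show ?thesis using * w by blast
qed

lemma nonneg:
  assumes s: "s = of_real r" "0 \<le> r"
  shows "\<forall>j\<le>K. (G K j \<in> \<real> \<and> 0 \<le> Re (G K j)) \<and> (C K j \<in> \<real> \<and> 0 \<le> Re (C K j))"
proof (induction K)
  case (Suc K)
  have "(\<Sum>i=j..<Suc K. G K i) \<in> \<real>" "0 \<le> Re (\<Sum>i=j..<Suc K. G K i)" for j
    using Suc.IH by (auto simp del: sum.op_ivl_Suc intro!: sum_in_Reals sum_nonneg)
  moreover have "(\<Sum>i=0..<j. C K i) \<in> \<real>" "0 \<le> Re (\<Sum>i=0..<j. C K i)" if "j \<le> Suc K" for j
    using Suc.IH that by (auto intro!: sum_in_Reals sum_nonneg)
  ultimately show ?case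
    using s by (auto simp: C_Suc G_Suc simp del: sum.op_ivl_Suc Re_sum intro!: Reals_add Reals_mult)
qed (simp add: G_0 C_0)

lemma weighted_sum_nonzero_real:
  fixes w :: "nat \<Rightarrow> real"
  assumes s: "s = of_real r" "0 \<le> r" and w: "0 < w 0" "\<And>j. 0 \<le> w j"
  shows "(\<Sum>j=0..<Suc K. of_real (w j) * G K j) \<noteq> 0"
proof -
  have *: "0 < Re (\<Sum>j=0..<Suc K. of_real (w j) * G K j)"
    if G0: "0 < Re (G K 0)" and w: "0 < w 0" "\<And>j. 0 \<le> w j" for K and w :: "nat \<Rightarrow> real"
  proof -
    have "0 \<le> Re (\<Sum>j=Suc 0..<Suc K. of_real (w j) * G K j)"
      using nonneg[OF s, of K] w by (auto simp del: sum.op_ivl_Suc intro!: sum_nonneg mult_nonneg_nonneg)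
    then show ?thesis
      using G0 w by (simp add: sum.atLeast_Suc_lessThan add_pos_nonneg del: sum.op_ivl_Suc Re_sum)
  qed
  have "0 < Re (G K 0)"
  proof (induction K)
    case (Suc K)
    then show ?case using *[of K "\<lambda>_. 1"] by (simp add: G_Suc)
  qed (simp add: G_0)
  then have "0 < Re (\<Sum>j=0..<Suc K. of_real (w j) * G K j)" using * w by blast
  then show ?thesis by (metis less_irrefl zero_complex.sel(1))
qed

end

section \<open>Derangement polynomials\<close>

definition qint :: "complex \<Rightarrow> nat \<Rightarrow> complex" where
  "qint t q = (\<Sum>i<q. t ^ i)"

lemma qint_0 [simp]: "qint t 0 = 0"
  by (simp add: qint_def)

lemma qint_Suc: "qint t (Suc q) = 1 + t * qint t q"
  by (simp add: qint_def sum.lessThan_Suc_shift sum_distrib_left del: sum.lessThan_Suc)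

lemma mult_qint: "(t - 1) * qint t q = t ^ q - 1"
  by (simp add: qint_def power_diff_1_eq)

text \<open>The generating function is taken at a fixed complex \<open>t\<close>. Its denominator
  has constant term \<open>t - 1\<close>, whence the assumption \<open>t \<noteq> 1\<close> in what
  follows.\<close>

definition derange :: "complex \<Rightarrow> nat \<Rightarrow> complex" where
  "derange t m =
     fact m * fps_nth (fps_const (t - 1) * inverse (fps_const t * fps_exp 1 - fps_exp t)) m"

lemma derange_fps:
  assumes "t \<noteq> 1"
  shows "Abs_fps (\<lambda>m. derange t m / fact m) * (fps_const t * fps_exp 1 - fps_exp t) =
    fps_const (t - 1)"
proof -
  have "Abs_fps (\<lambda>m. derange t m / fact m) =
      fps_const (t - 1) * inverse (fps_const t * fps_exp 1 - fps_exp t)"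
    by (rule fps_ext) (simp add: derange_def)
  then show ?thesis
    using assms by (simp add: mult.assoc inverse_mult_eq_1)
qed

lemma fps_nth_egf_mult_exp:
  fixes a :: "nat \<Rightarrow> 'a::field_char_0"
  shows "fact p * fps_nth (Abs_fps (\<lambda>m. a m / fact m) * fps_exp c) p =
    (\<Sum>i\<le>p. of_nat (p choose i) * a i * c ^ (p - i))"
  unfolding fps_mult_nth sum_distrib_left atLeast0AtMost
  by (intro sum.cong) (auto simp: binomial_fact)

text \<open>Multiplying the identity for the generating function by the exponential series of
  \<open>- 1\<close> leaves \<open>fps_exp (t - 1)\<close> in the denominator; coefficients are then
  compared. The powers of \<open>t - 1\<close> are those of the characteristic polynomials of
  Boolean intervals.\<close>

lemma derange_char_sum:
  assumes "t \<noteq> 1"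
  shows "t * derange t p =
    (\<Sum>i\<le>p. of_nat (p choose i) * derange t i * (t - 1) ^ (p - i)) + (- 1) ^ p * (t - 1)"
proof -
  let ?D = "Abs_fps (\<lambda>m. derange t m / fact m)"
  have "fps_exp 1 * fps_exp (- 1) = (1 :: complex fps)"
    "fps_exp t * fps_exp (- 1) = fps_exp (t - 1)"
    by (simp_all flip: fps_exp_add_mult)
  then have "?D * (fps_const t - fps_exp (t - 1)) =
      ?D * (fps_const t * fps_exp 1 - fps_exp t) * fps_exp (- 1)"
    by (simp add: left_diff_distrib mult.assoc)
  also have "\<dots> = fps_const (t - 1) * fps_exp (- 1)"
    using derange_fps[OF assms] by simp
  finally have "fps_const t * ?D = ?D * fps_exp (t - 1) + fps_const (t - 1) * fps_exp (- 1)"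
    by (simp add: algebra_simps)
  then have "fact p * fps_nth (fps_const t * ?D) p =
      fact p * fps_nth (?D * fps_exp (t - 1)) p + fact p * fps_nth (fps_const (t - 1) * fps_exp (- 1)) p"
    by (simp add: algebra_simps)
  then show ?thesis
    unfolding fps_nth_egf_mult_exp by (simp add: mult.commute)
qed

lemma derange_Suc:
  assumes t: "t \<noteq> 1"
  shows "derange t (Suc K) =
    t * (\<Sum>m\<le>K. of_nat (Suc K choose m) * (qint t (K - m) * derange t m))"
proof -
  let ?D = "Abs_fps (\<lambda>m. derange t m / fact m)"
  have "t * (fact (Suc K) * fps_nth (?D * fps_exp 1) (Suc K)) -
      fact (Suc K) * fps_nth (?D * fps_exp t) (Suc K) =
      fact (Suc K) * fps_nth (?D * (fps_const t * fps_exp 1 - fps_exp t)) (Suc K)"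
    by (simp add: algebra_simps mult.left_commute[of _ "fps_const t"])
  also have "\<dots> = 0" using derange_fps[OF t] by simp
  finally have "(\<Sum>m\<le>Suc K. of_nat (Suc K choose m) * derange t m * (t - t ^ (Suc K - m))) = 0"
    unfolding fps_nth_egf_mult_exp by (simp add: algebra_simps sum_distrib_left sum_subtractf
      del: sum.atMost_Suc)
  \<comment> \<open>The summand \<open>m = Suc K\<close> has the factor
    \<open>t - t ^ 0 = t - 1\<close> and becomes the left-hand side.\<close>
  then have "(t - 1) * derange t (Suc K) =
      (\<Sum>m\<le>K. of_nat (Suc K choose m) * derange t m * (t ^ (Suc K - m) - t))"
    by (simp add: algebra_simps sum_subtractf)
  also have "\<dots> = (\<Sum>m\<le>K. of_nat (Suc K choose m) * derange t m * (t * ((t - 1) * qint t (K - m))))"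
    unfolding mult_qint by (intro sum.cong) (auto simp: Suc_diff_le algebra_simps)
  also have "\<dots> = (t - 1) * (t * (\<Sum>m\<le>K. of_nat (Suc K choose m) * (qint t (K - m) * derange t m)))"
    by (simp add: sum_distrib_left algebra_simps)
  finally show ?thesis using t by simp
qed

lemma derange_0: "t \<noteq> 1 \<Longrightarrow> derange t 0 = 1"
  by (simp add: derange_def)

section \<open>Change of basis by Pascal's rule\<close>

text \<open>\<open>binsum \<phi> N j\<close> is the image of \<open>x\<^sup>j (1 + x)\<^sup>N\<close> under the linear map \<open>x\<^sup>m \<mapsto> \<phi> m\<close>.\<close>

primrec binsum :: "(nat \<Rightarrow> complex) \<Rightarrow> nat \<Rightarrow> nat \<Rightarrow> complex" where
  "binsum \<phi> 0 j = \<phi> j"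
| "binsum \<phi> (Suc N) j = binsum \<phi> N j + binsum \<phi> N (Suc j)"

lemma binsum_shift: "binsum \<phi> N (Suc j) = binsum (\<lambda>m. \<phi> (Suc m)) N j"
  by (induction N arbitrary: j) auto

text \<open>In terms of polynomials, \<open>x^j (1+x)^(M+1-j)\<close> and
  \<open>x^(j+1) (1+x)^(M-j)\<close> differ by \<open>x^j (1+x)^(M-j)\<close>; these differences are
  summed up to \<open>x^(M+1)\<close>.\<close>

lemma binsum_telescope:
  "j \<le> Suc M \<Longrightarrow> binsum \<phi> (Suc M - j) j = \<phi> (Suc M) + (\<Sum>i=j..<Suc M. binsum \<phi> (M - i) i)"
proof (induction j rule: inc_induct)
  case (step j)
  then have "binsum \<phi> (Suc M - j) j = binsum \<phi> (M - j) j + binsum \<phi> (Suc M - Suc j) (Suc j)"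
    by (simp add: Suc_diff_le)
  then show ?case
    using step by (simp add: sum.atLeast_Suc_lessThan del: sum.op_ivl_Suc)
qed simp

text \<open>This is the elimination step. The series of \<open>(1-y)^(-r-1)\<close> at
  \<open>y = x/(1+x)\<close> is \<open>(1+x)^(r+1)\<close>. Multiplied by \<open>(1+x)^N\<close> and
  cut off after degree \<open>N\<close>, it expands the truncated row \<open>Suc (r + N)\<close> of
  Pascal's triangle in the polynomials \<open>x^j (1+x)^(N-j)\<close> with nonnegative
  coefficients.\<close>

lemma sum_choose_binsum:
  "(\<Sum>m\<le>N. of_nat (Suc (r + N) choose m) * \<phi> m) =
   (\<Sum>j\<le>N. of_nat (r + j choose j) * binsum \<phi> (N - j) j)"
proof (induction N arbitrary: \<phi>)
  case (Suc N)
  have "(\<Sum>j\<le>Suc N. of_nat (r + j choose j) * binsum \<phi> (Suc N - j) j) =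
      (\<Sum>j\<le>N. of_nat (r + j choose j) * binsum \<phi> (N - j) j) +
      (\<Sum>j\<le>N. of_nat (r + j choose j) * binsum (\<lambda>m. \<phi> (Suc m)) (N - j) j) +
      of_nat (Suc (r + N) choose Suc N) * \<phi> (Suc N)"
    by (simp add: Suc_diff_le binsum_shift algebra_simps flip: sum.distrib)
  also have "\<dots> = (\<Sum>m\<le>Suc N. of_nat (Suc (r + N) choose m) * \<phi> m) +
      (\<Sum>m\<le>N. of_nat (Suc (r + N) choose m) * \<phi> (Suc m))"
    unfolding Suc[symmetric] by simp
  also have "\<dots> = (\<Sum>m\<le>Suc N. of_nat (Suc (r + Suc N) choose m) * \<phi> m)"
    by (simp add: sum.atMost_Suc_shift algebra_simps del: sum.atMost_Suc flip: sum.distrib)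
  finally show ?case ..
qed simp

text \<open>The bound on \<open>m\<close> is the degree of \<open>x^j (1+x)^N\<close>. It matters
  for \<open>gpart_eq\<close>, where truncated subtraction can spoil the relation between the
  q-integers for larger \<open>m\<close>.\<close>

lemma binsum_linear:
  "(\<And>m. m \<le> N + j \<Longrightarrow> \<phi> m = \<psi> m + c * \<theta> m) \<Longrightarrow>
   binsum \<phi> N j = binsum \<psi> N j + c * binsum \<theta> N j"
  by (induction N arbitrary: j) (simp_all add: algebra_simps)

section \<open>The summands independent of n and their recursion\<close>

definition qder :: "complex \<Rightarrow> nat \<Rightarrow> nat \<Rightarrow> complex" where
  "qder t k m = qint t (k - m) * derange t m"

text \<open>The polynomials \<open>g\<^sub>0, \<dots>, g\<^sub>K\<close> for \<open>k = K + 1\<close>, and the auxiliary family that closes the recursion.\<close>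

definition gpart :: "complex \<Rightarrow> nat \<Rightarrow> nat \<Rightarrow> complex" where
  "gpart t K j = binsum (qder t (Suc K)) (K - j) j"

definition cpart :: "complex \<Rightarrow> nat \<Rightarrow> nat \<Rightarrow> complex" where
  "cpart t K j = binsum (qder t K) (K - j) j"

text \<open>The boundary term of the telescoping sum is \<open>qder t (Suc K) (Suc K)\<close>, which
  is zero because \<open>qint t 0 = 0\<close>.\<close>

lemma cpart_Suc: "j \<le> Suc K \<Longrightarrow> cpart t (Suc K) j = (\<Sum>i=j..<Suc K. gpart t K i)"
  using binsum_telescope[of j K "qder t (Suc K)"] by (simp add: cpart_def gpart_def qder_def)

lemma gpart_eq:
  assumes "j \<le> K"
  shows "gpart t K j = binsum (derange t) (K - j) j + t * cpart t K j"
  unfolding gpart_def cpart_def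
  by (rule binsum_linear) (use assms in \<open>auto simp: qder_def Suc_diff_le qint_Suc algebra_simps\<close>)

text \<open>Telescoping produces the boundary term \<open>derange t (Suc K)\<close>, which is
  \<open>t\<close> times the sum of all \<open>cpart t K i\<close>. The part with
  \<open>i \<ge> j\<close> is absorbed by \<open>gpart_eq\<close> into a second copy of the tail
  sum; the part with \<open>i < j\<close> remains. No subtraction occurs.\<close>

lemma gpart_Suc:
  assumes "t \<noteq> 1" "j \<le> Suc K"
  shows "gpart t (Suc K) j = (1 + t) * (\<Sum>i=j..<Suc K. gpart t K i) + t * (\<Sum>i=0..<j. cpart t K i)"
proof -
  \<comment> \<open>The instance \<open>r = 0\<close> of \<open>sum_choose_binsum\<close> is
    prepared here: all its coefficients are 1.\<close>
  have "derange t (Suc K) = t * (\<Sum>m\<le>K. of_nat (Suc (0 + K) choose m) * qder t K m)"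
    using derange_Suc[OF assms(1), of K] by (simp add: qder_def)
  also have "\<dots> = t * (\<Sum>i\<le>K. cpart t K i)"
    unfolding sum_choose_binsum by (simp add: cpart_def)
  also have "(\<Sum>i\<le>K. cpart t K i) = (\<Sum>i=0..<j. cpart t K i) + (\<Sum>i=j..<Suc K. cpart t K i)"
    using assms sum.atLeastLessThan_concat[of 0 j "Suc K" "cpart t K"]
    by (simp add: atLeast0LessThan lessThan_Suc_atMost del: sum.op_ivl_Suc)
  finally have d: "derange t (Suc K) =
      t * ((\<Sum>i=0..<j. cpart t K i) + (\<Sum>i=j..<Suc K. cpart t K i))" .
  have "(\<Sum>i=j..<Suc K. gpart t K i) =
      (\<Sum>i=j..<Suc K. binsum (derange t) (K - i) i + t * cpart t K i)"
    by (intro sum.cong gpart_eq) auto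
  then have "binsum (derange t) (Suc K - j) j =
      t * (\<Sum>i=0..<j. cpart t K i) + (\<Sum>i=j..<Suc K. gpart t K i)"
    unfolding binsum_telescope[OF assms(2)] d
    by (simp add: sum.distrib sum_distrib_left algebra_simps del: sum.op_ivl_Suc)
  then show ?thesis
    unfolding gpart_eq[OF assms(2)] cpart_Suc[OF assms(2)]
    by (simp add: algebra_simps del: sum.op_ivl_Suc)
qed

definition uchow :: "complex \<Rightarrow> nat \<Rightarrow> nat \<Rightarrow> complex" where
  "uchow t k n = (\<Sum>m<k. of_nat (n choose m) * qder t k m)"

lemma uchow_gpart:
  assumes "Suc K \<le> n"
  shows "uchow t (Suc K) n = (\<Sum>j\<le>K. of_nat (n - Suc K + j choose j) * gpart t K j)"
  using sum_choose_binsum[where r = "n - Suc K" and N = K and \<phi> = "qder t (Suc K)"] assms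
  by (simp add: uchow_def gpart_def lessThan_Suc_atMost)

text \<open>This is the defining recursion of the Chow polynomial times \<open>t - 1\<close>, with
  elements grouped by rank and the term \<open>m = 0\<close> added on both sides. Regrouping the
  double sum by \<open>p = m + i\<close> turns the inner sums into those of
  \<open>derange_char_sum\<close>.\<close>

lemma uchow_recursion:
  assumes t: "t \<noteq> 1"
  shows "t * uchow t k n =
    (\<Sum>m<k. of_nat (n choose m) * (t - 1) ^ m * uchow t (k - m) (n - m)) +
    (\<Sum>p<k. of_nat (n choose p) * (- 1) ^ p * (t ^ (k - p) - 1))"
proof -
  have bin: "(n choose m) * (n - m choose i) = (n choose (m + i)) * (m + i choose i)" for m i
  proof (cases "m + i \<le> n")
    case True
    then show ?thesis
      using choose_mult[of m "m + i" n] binomial_symmetric[of m "m + i"] by simp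
  qed (auto simp: binomial_eq_0)
  have "(\<Sum>m<k. of_nat (n choose m) * (t - 1) ^ m * uchow t (k - m) (n - m)) =
      (\<Sum>m<k. \<Sum>i<k - m. of_nat (n choose (m + i)) * of_nat (m + i choose i) * (t - 1) ^ m *
        (qint t (k - (m + i)) * derange t i))"
    unfolding uchow_def sum_distrib_left
  proof (intro sum.cong refl)
    fix m i
    have "of_nat (n choose m) * of_nat (n - m choose i) =
        (of_nat (n choose (m + i)) * of_nat (m + i choose i) :: complex)"
      by (simp only: bin flip: of_nat_mult)
    then show "of_nat (n choose m) * (t - 1) ^ m * (of_nat (n - m choose i) * qder t (k - m) i) =
        of_nat (n choose (m + i)) * of_nat (m + i choose i) * (t - 1) ^ m *
        (qint t (k - (m + i)) * derange t i)"
      by (simp add: qder_def mult_ac)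
  qed
  also have "\<dots> = (\<Sum>p<k. \<Sum>i\<le>p. of_nat (n choose p) * of_nat (p choose i) * (t - 1) ^ (p - i) *
        (qint t (k - p) * derange t i))"
    unfolding sum.Sigma[OF finite_lessThan ballI[OF finite_lessThan]]
      sum.Sigma[OF finite_lessThan ballI[OF finite_atMost]]
    by (rule sum.reindex_bij_witness[of _ "\<lambda>(p, i). (p - i, i)" "\<lambda>(m, i). (m + i, i)"]) auto
  also have "\<dots> = (\<Sum>p<k. of_nat (n choose p) * qint t (k - p) *
        (\<Sum>i\<le>p. of_nat (p choose i) * derange t i * (t - 1) ^ (p - i)))"
    unfolding sum_distrib_left by (intro sum.cong) (auto simp: mult_ac)
  also have "\<dots> = (\<Sum>p<k. of_nat (n choose p) * qint t (k - p) *
        (t * derange t p - (- 1) ^ p * (t - 1)))"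
    using derange_char_sum[OF t] by simp
  also have "\<dots> = t * uchow t k n -
      (\<Sum>p<k. of_nat (n choose p) * (- 1) ^ p * (t ^ (k - p) - 1))"
    unfolding uchow_def qder_def mult_qint[symmetric] sum_distrib_left sum_subtractf[symmetric]
    by (intro sum.cong) (auto simp: algebra_simps)
  finally show ?thesis by simp
qed

section \<open>The Chow polynomial of the uniform lattice\<close>

lemma sum_subsets_by_card:
  fixes f :: "nat \<Rightarrow> 'b::comm_ring_1"
  assumes A: "finite A"
  shows "(\<Sum>Y | Y \<subseteq> A \<and> card Y < k. f (card Y)) = (\<Sum>m<k. of_nat (card A choose m) * f m)"
proof -
  have fin: "finite {Y. Y \<subseteq> A \<and> card Y < k}"
    by (rule finite_subset[of _ "Pow A"]) (use A in auto)
  have "(\<Sum>Y | Y \<subseteq> A \<and> card Y < k. f (card Y)) =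
      (\<Sum>m<k. \<Sum>Y | Y \<in> {Y. Y \<subseteq> A \<and> card Y < k} \<and> card Y = m. f (card Y))"
    by (rule sum.group[symmetric]) (use fin in auto)
  also have "\<dots> = (\<Sum>m<k. of_nat (card A choose m) * f m)"
  proof (rule sum.cong)
    fix m assume "m \<in> {..<k}"
    then have "{Y \<in> {Y. Y \<subseteq> A \<and> card Y < k}. card Y = m} = {Y. Y \<subseteq> A \<and> card Y = m}"
      by auto
    then show "(\<Sum>Y | Y \<in> {Y. Y \<subseteq> A \<and> card Y < k} \<and> card Y = m. f (card Y)) =
        of_nat (card A choose m) * f m"
      using n_subsets[OF A, of m] by simp
  qed simp
  finally show ?thesis .
qed

lemma sum_supersets_by_card:
  fixes f :: "nat \<Rightarrow> 'b::comm_ring_1"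
  assumes A: "finite A" and S: "S \<subseteq> A"
  shows "(\<Sum>Z | S \<subseteq> Z \<and> Z \<subseteq> A \<and> card Z < k. f (card Z)) =
    (\<Sum>m<k - card S. of_nat (card A - card S choose m) * f (card S + m))"
proof -
  have fin: "finite Z" if "Z \<subseteq> A" for Z using that A finite_subset by blast
  have c: "card (S \<union> Y) = card S + card Y" if "Y \<subseteq> A - S" for Y
    using that fin[of Y] fin[OF S] by (intro card_Un_disjoint) auto
  have d: "card (Z - S) = card Z - card S" if "S \<subseteq> Z" for Z
    using that fin[OF S] by (simp add: card_Diff_subset)
  have "(\<Sum>Z | S \<subseteq> Z \<and> Z \<subseteq> A \<and> card Z < k. f (card Z)) =
      (\<Sum>Y | Y \<subseteq> A - S \<and> card Y < k - card S. f (card S + card Y))"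
  proof (rule sum.reindex_bij_witness[of _ "\<lambda>Y. S \<union> Y" "\<lambda>Z. Z - S"])
    fix Z assume Z: "Z \<in> {Z. S \<subseteq> Z \<and> Z \<subseteq> A \<and> card Z < k}"
    then have "card S \<le> card Z" using fin by (intro card_mono) auto
    with Z show "Z - S \<in> {Y. Y \<subseteq> A - S \<and> card Y < k - card S}"
      and "f (card S + card (Z - S)) = f (card Z)" by (auto simp: d)
  qed (use S in \<open>auto simp: c\<close>)
  also have "\<dots> = (\<Sum>m<k - card S. of_nat (card (A - S) choose m) * f (card S + m))"
    by (rule sum_subsets_by_card) (use A in auto)
  finally show ?thesis using S fin by (simp add: card_Diff_subset)
qed

section \<open>Evaluation of integer polynomials at complex points\<close>

abbreviation (input) ipoly :: "int poly \<Rightarrow> complex \<Rightarrow> complex" where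
  "ipoly p t \<equiv> poly (map_poly of_int p) t"

lemma ipoly_add: "ipoly (p + q) t = ipoly p t + ipoly q t"
proof -
  have "map_poly of_int (p + q) = (map_poly of_int p + map_poly of_int q :: complex poly)"
    by (rule poly_eqI) (simp add: coeff_map_poly)
  then show ?thesis by simp
qed

lemma ipoly_mult: "ipoly (p * q) t = ipoly p t * ipoly q t"
proof -
  have "map_poly of_int (p * q) = (map_poly of_int p * map_poly of_int q :: complex poly)"
    by (rule poly_eqI) (simp add: coeff_map_poly coeff_mult)
  then show ?thesis by simp
qed

lemma ipoly_sum: "ipoly (\<Sum>i\<in>A. f i) t = (\<Sum>i\<in>A. ipoly (f i) t)"
  by (induction A rule: infinite_finite_induct) (auto simp: ipoly_add)

lemma ipoly_monom: "ipoly (monom c i) t = of_int c * t ^ i"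
  by (simp add: map_poly_monom poly_monom)

lemma ipoly_cnj: "ipoly p (cnj t) = cnj (ipoly p t)"
proof -
  have "map_poly cnj (map_poly of_int p) = map_poly of_int p"
    by (rule poly_eqI) (simp add: coeff_map_poly)
  then show ?thesis by (metis poly_cnj)
qed

section \<open>Intervals of the uniform lattice\<close>

locale uniform_poset =
  fixes k n :: nat and A :: "nat set" and P :: "nat set set"
  assumes k: "1 \<le> k" "k \<le> n"
  defines "A \<equiv> {1..n}"
  defines "P \<equiv> insert A {S. S \<subseteq> A \<and> card S < k}"
begin

lemma A: "finite A" "card A = n" "A \<in> P"
  by (simp_all add: A_def P_def)

lemma finite_P: "finite P"
  unfolding P_def by (rule finite_subset[of _ "Pow A"]) (auto simp: A_def)

lemma P_iff: "S \<noteq> A \<Longrightarrow> S \<in> P \<longleftrightarrow> S \<subseteq> A \<and> card S < k"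
  by (auto simp: P_def)

lemma P_subset: "S \<in> P \<Longrightarrow> S \<subseteq> A"
  by (auto simp: P_def)

lemma small: "card S < k \<Longrightarrow> S \<noteq> A"
  using A k by auto

lemma fin: "S \<in> P \<Longrightarrow> finite S"
  using P_subset A finite_subset by blast

lemma rank_P: "rank_in P A = k" "S \<in> P \<Longrightarrow> S \<noteq> A \<Longrightarrow> rank_in P S = card S"
  using uniform_explicit(1)[OF k] by (auto simp: P_def A_def uniform_rank_def)

text \<open>All subsets of a proper element have fewer than \<open>k\<close> elements and so lie in
  \<open>P\<close>: such intervals are Boolean. The top is treated separately, since its rank
  \<open>k\<close> need not be its cardinality \<open>n\<close>.\<close>

lemma interval_below:
  assumes "T \<in> P" "T \<noteq> A"
  shows "{Z\<in>P. S \<subseteq> Z \<and> Z \<subseteq> T} = {Z. S \<subseteq> Z \<and> Z \<subseteq> T \<and> card Z < Suc (card T)}"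
    and "{Z\<in>P. S \<subseteq> Z \<and> Z \<subset> T} = {Z. S \<subseteq> Z \<and> Z \<subseteq> T \<and> card Z < card T}"
proof -
  have T: "T \<subseteq> A" "card T < k" "finite T" using assms P_iff fin by auto
  have "Z \<in> P" "card Z \<le> card T" if "Z \<subseteq> T" for Z
    using that T card_mono[of T Z] by (auto simp: P_def)
  then show "{Z\<in>P. S \<subseteq> Z \<and> Z \<subseteq> T} = {Z. S \<subseteq> Z \<and> Z \<subseteq> T \<and> card Z < Suc (card T)}"
    "{Z\<in>P. S \<subseteq> Z \<and> Z \<subset> T} = {Z. S \<subseteq> Z \<and> Z \<subseteq> T \<and> card Z < card T}"
    using psubset_card_mono[OF T(3)] by (auto simp: less_Suc_eq_le)
qed

lemma interval_top:
  assumes "S \<in> P" "S \<noteq> A"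
  shows "{Z\<in>P. S \<subseteq> Z \<and> Z \<subseteq> A} = insert A {Z. S \<subseteq> Z \<and> Z \<subseteq> A \<and> card Z < k}"
    and "{Z\<in>P. S \<subseteq> Z \<and> Z \<subset> A} = {Z. S \<subseteq> Z \<and> Z \<subseteq> A \<and> card Z < k}"
  using assms P_subset[of S] small by (auto simp: P_def)

lemma moebius_below:
  assumes "S \<in> P" "T \<in> P" "T \<noteq> A" "S \<subseteq> T"
  shows "moebius P S T = (- 1) ^ (card T - card S)"
  using assms
proof (induction "card T" arbitrary: T rule: less_induct)
  case less
  show ?case
  proof (cases "S = T")
    case True
    then show ?thesis using less.prems finite_P by (simp add: moebius.simps)
  next
    case False
    define N where "N = card T - card S"
    have T: "finite T" using less.prems fin by auto
    then have "card S < card T" using False less.prems by (intro psubset_card_mono) auto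
    then have N: "0 < N" by (simp add: N_def)
    have "moebius P S T = - (\<Sum>Z | Z \<in> P \<and> S \<subseteq> Z \<and> Z \<subset> T. moebius P S Z)"
      using False less.prems finite_P by (subst moebius.simps) (auto intro!: sum.cong)
    also have "(\<Sum>Z | Z \<in> P \<and> S \<subseteq> Z \<and> Z \<subset> T. moebius P S Z) =
        (\<Sum>Z | Z \<in> P \<and> S \<subseteq> Z \<and> Z \<subset> T. (- 1) ^ (card Z - card S))"
      using less.prems P_subset[of T] T
      by (intro sum.cong refl less.hyps) (auto intro: psubset_card_mono)
    also have "\<dots> = (\<Sum>m<N. of_nat (N choose m) * (- 1) ^ m)"
      unfolding interval_below[OF less.prems(2,3)] N_def
      using sum_supersets_by_card[OF T less.prems(4), of "\<lambda>c. (- 1) ^ (c - card S)" "card T"] by simp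
    also have "\<dots> = - ((- 1) ^ N)"
      using choose_alternating_sum[OF N, where 'a = int]
      by (simp add: lessThan_Suc_atMost[symmetric] mult.commute add_eq_0_iff2)
    finally show ?thesis by (simp add: N_def)
  qed
qed

lemma red_char_below:
  assumes "S \<in> P" "T \<in> P" "T \<noteq> A" "S \<subset> T"
  shows "(t - 1) * ipoly (red_char_poly_in P S T) t = (t - 1) ^ (card T - card S)"
proof -
  define N where "N = card T - card S"
  have ST: "S \<subseteq> T" "finite T" using assms fin by auto
  have c: "card S < card T" using assms ST by (intro psubset_card_mono) auto
  have "(t - 1) * ipoly (red_char_poly_in P S T) t =
      ipoly ([:- 1, 1:] * red_char_poly_in P S T) t"
    unfolding ipoly_mult by (simp add: map_poly_pCons)
  also have "\<dots> = ipoly (char_poly_in P S T) t"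
    using red_char_poly_in_mult[OF finite_P assms(1,2,4)] by simp
  also have "\<dots> = (\<Sum>Z | Z \<in> P \<and> S \<subseteq> Z \<and> Z \<subseteq> T.
      of_int (moebius P S Z) * t ^ (rank_in P T - rank_in P Z))"
    by (simp add: char_poly_in_def ipoly_sum ipoly_monom)
  also have "\<dots> = (\<Sum>Z | Z \<in> P \<and> S \<subseteq> Z \<and> Z \<subseteq> T. (- 1) ^ (card Z - card S) * t ^ (card T - card Z))"
  proof (intro sum.cong refl)
    fix Z assume Z: "Z \<in> {Z\<in>P. S \<subseteq> Z \<and> Z \<subseteq> T}"
    then have "Z \<noteq> A" using assms P_subset[of T] by auto
    with Z assms show "of_int (moebius P S Z) * t ^ (rank_in P T - rank_in P Z) =
        (- 1) ^ (card Z - card S) * t ^ (card T - card Z)"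
      by (simp add: moebius_below rank_P)
  qed
  also have "\<dots> = (\<Sum>m<Suc N. of_nat (N choose m) * ((- 1) ^ m * t ^ (N - m)))"
    unfolding interval_below[OF assms(2,3)]
    using sum_supersets_by_card[OF ST(2,1),
        of "\<lambda>c. (- 1) ^ (c - card S) * t ^ (card T - c)" "Suc (card T)"] c
    by (simp add: N_def Suc_diff_le)
  also have "\<dots> = (t - 1) ^ N"
    using binomial_ring[of "- 1" t N] by (simp add: lessThan_Suc_atMost mult.assoc)
  finally show ?thesis by (simp add: N_def)
qed

text \<open>The Moebius value at the top is minus the sum of the others and enters with exponent 0.
  Distributing it over the other terms turns each power of \<open>t\<close> into that power minus
  1.\<close>

lemma red_char_top:
  assumes "S \<in> P" "S \<noteq> A"
  shows "(t - 1) * ipoly (red_char_poly_in P S A) t =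
    (\<Sum>m<k - card S. of_nat (n - card S choose m) * (- 1) ^ m * (t ^ (k - card S - m) - 1))"
proof -
  define B where "B = {Z. S \<subseteq> Z \<and> Z \<subseteq> A \<and> card Z < k}"
  have S: "S \<subseteq> A" "S < A" using assms P_subset by auto
  have B: "finite B" "A \<notin> B"
    using A small finite_subset[of B "Pow A"] by (auto simp: B_def)
  have BP: "Z \<in> P" "Z \<noteq> A" "S \<subseteq> Z" if "Z \<in> B" for Z
    using that small by (auto simp: B_def P_def)
  have mu: "moebius P S A = - (\<Sum>Z\<in>B. (- 1) ^ (card Z - card S))"
  proof -
    have "moebius P S A = - (\<Sum>Z | Z \<in> P \<and> S \<subseteq> Z \<and> Z \<subset> A. moebius P S Z)"
      using assms S A finite_P by (subst moebius.simps) (auto intro!: sum.cong)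
    also have "\<dots> = - (\<Sum>Z\<in>B. moebius P S Z)"
      unfolding interval_top[OF assms] B_def ..
    finally show ?thesis using BP assms by (simp add: moebius_below)
  qed
  have "(t - 1) * ipoly (red_char_poly_in P S A) t =
      ipoly ([:- 1, 1:] * red_char_poly_in P S A) t"
    unfolding ipoly_mult by (simp add: map_poly_pCons)
  also have "\<dots> = ipoly (char_poly_in P S A) t"
    using red_char_poly_in_mult[OF finite_P assms(1) A(3) S(2)] by simp
  also have "\<dots> = (\<Sum>Z | Z \<in> P \<and> S \<subseteq> Z \<and> Z \<subseteq> A.
      of_int (moebius P S Z) * t ^ (k - rank_in P Z))"
    by (simp add: char_poly_in_def ipoly_sum ipoly_monom rank_P)
  also have "\<dots> = of_int (moebius P S A) + (\<Sum>Z\<in>B. of_int (moebius P S Z) * t ^ (k - rank_in P Z))"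
    unfolding interval_top[OF assms] B_def[symmetric] using B by (simp add: rank_P)
  also have "(\<Sum>Z\<in>B. of_int (moebius P S Z) * t ^ (k - rank_in P Z)) =
      (\<Sum>Z\<in>B. (- 1) ^ (card Z - card S) * t ^ (k - card Z))"
    using BP assms by (intro sum.cong refl) (simp add: moebius_below rank_P)
  also have "of_int (moebius P S A) + \<dots> = (\<Sum>Z\<in>B. (- 1) ^ (card Z - card S) * (t ^ (k - card Z) - 1))"
    unfolding mu by (simp add: algebra_simps sum_subtractf)
  also have "\<dots> = (\<Sum>m<k - card S. of_nat (n - card S choose m) * ((- 1) ^ m * (t ^ (k - card S - m) - 1)))"
    unfolding B_def
    using sum_supersets_by_card[OF A(1) S(1), of "\<lambda>c. (- 1) ^ (c - card S) * (t ^ (k - c) - 1)" k]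
    by (simp add: A)
  finally show ?thesis by (simp add: mult.assoc)
qed

lemma chow_poly_in_top:
  assumes t: "t \<noteq> 1" and "S \<in> P" "S \<noteq> A"
  shows "ipoly (chow_poly_in P S A) t = uchow t (k - card S) (n - card S)"
  using assms(2,3)
proof (induction "k - card S" arbitrary: S rule: less_induct)
  case less
  define B where "B = {Z. S \<subseteq> Z \<and> Z \<subseteq> A \<and> card Z < k}"
  define k' n' where "k' = k - card S" and "n' = n - card S"
  have S: "S \<subseteq> A" "S \<subset> A" "card S < k" using less.prems P_iff by auto
  have B: "finite B" "A \<notin> B" "S \<in> B"
    using A small S finite_subset[of B "Pow A"] by (auto simp: B_def)
  have BP: "Z \<in> P" "Z \<noteq> A" "S \<subseteq> Z" if "Z \<in> B" for Z
    using that small by (auto simp: B_def P_def)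
  have step: "(t - 1) * ipoly (red_char_poly_in P S Z * chow_poly_in P Z A) t =
      (t - 1) ^ (card Z - card S) * uchow t (k - card Z) (n - card Z)" if Z: "Z \<in> B - {S}" for Z
  proof -
    have "S \<subset> Z" using Z BP by auto
    then have "card S < card Z" using BP Z fin by (intro psubset_card_mono) auto
    moreover have "card Z < k" using Z by (simp add: B_def)
    ultimately have "ipoly (chow_poly_in P Z A) t = uchow t (k - card Z) (n - card Z)"
      using Z BP by (intro less.hyps) auto
    then show ?thesis
      using red_char_below[OF less.prems(1) _ _ \<open>S \<subset> Z\<close>, of t] BP[of Z] Z
      by (simp add: ipoly_mult mult.assoc[symmetric])
  qed
  have "{Z\<in>P. S \<subset> Z \<and> Z \<subseteq> A} = {Z\<in>P. S \<subseteq> Z \<and> Z \<subseteq> A} - {S}"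
    by auto
  also have "\<dots> = insert A (B - {S})"
    unfolding interval_top[OF less.prems] B_def[symmetric] using less.prems(2) by auto
  finally have "{Z\<in>P. S \<subset> Z \<and> Z \<subseteq> A} = insert A (B - {S})" .
  then have "chow_poly_in P S A = (\<Sum>Z\<in>insert A (B - {S}). red_char_poly_in P S Z * chow_poly_in P Z A)"
    using S less.prems A finite_P by (subst chow_poly_in.simps) auto
  also have "\<dots> = red_char_poly_in P S A + (\<Sum>Z\<in>B - {S}. red_char_poly_in P S Z * chow_poly_in P Z A)"
    using B A finite_P by (simp add: chow_poly_in.simps[of P A A])
  finally have "(t - 1) * ipoly (chow_poly_in P S A) t =
      (t - 1) * ipoly (red_char_poly_in P S A) t +
      (\<Sum>Z\<in>B - {S}. (t - 1) * ipoly (red_char_poly_in P S Z * chow_poly_in P Z A) t)"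
    by (simp add: ipoly_add ipoly_sum distrib_left sum_distrib_left)
  also have "\<dots> = (t - 1) * ipoly (red_char_poly_in P S A) t +
      (\<Sum>Z\<in>B - {S}. (t - 1) ^ (card Z - card S) * uchow t (k - card Z) (n - card Z))"
    using step by simp
  \<comment> \<open>The term \<open>Z = S\<close>, absent from the recursion, would be
    \<open>uchow t k' n'\<close>. Adding it completes the sum to the one in
    \<open>uchow_recursion\<close>.\<close>
  also have "(\<Sum>Z\<in>B - {S}. (t - 1) ^ (card Z - card S) * uchow t (k - card Z) (n - card Z)) =
      (\<Sum>Z\<in>B. (t - 1) ^ (card Z - card S) * uchow t (k - card Z) (n - card Z)) - uchow t k' n'"
    using B by (simp add: sum_diff1 k'_def n'_def)
  also have "(\<Sum>Z\<in>B. (t - 1) ^ (card Z - card S) * uchow t (k - card Z) (n - card Z)) =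
      (\<Sum>m<k'. of_nat (n' choose m) * (t - 1) ^ m * uchow t (k' - m) (n' - m))"
    unfolding B_def k'_def n'_def
    using sum_supersets_by_card[OF A(1) S(1),
        of "\<lambda>c. (t - 1) ^ (c - card S) * uchow t (k - c) (n - c)" k]
    by (simp add: A mult.assoc)
  also have "(t - 1) * ipoly (red_char_poly_in P S A) t + (\<dots> - uchow t k' n') =
      t * uchow t k' n' - uchow t k' n'"
    unfolding red_char_top[OF less.prems] uchow_recursion[OF t] k'_def n'_def by simp
  also have "\<dots> = (t - 1) * uchow t k' n'"
    by (simp add: algebra_simps)
  finally show ?case using t by (simp add: k'_def n'_def)
qed

end

lemma ipoly_chow_uniform:
  assumes "1 \<le> k" "k \<le> n" "t \<noteq> 1"
  shows "ipoly (chow_poly (uniform_lattice k n)) t = uchow t k n"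
proof -
  interpret uniform_poset k n "{1..n}" "insert {1..n} {S. S \<subseteq> {1..n} \<and> card S < k}"
    using assms by unfold_locales
  let ?P = "insert {1..n} {S. S \<subseteq> {1..n} \<and> card S < k}"
  have "(LEAST x. x \<in> ?P) = {}"
    by (rule Least_in_eqI) (use assms in auto)
  moreover have "(GREATEST x. x \<in> ?P) = {1..n}"
    by (rule Greatest_in_eqI) auto
  ultimately show ?thesis
    using chow_poly_in_top[OF assms(3), of "{}"] assms
    by (simp add: chow_poly_def uniform_lattice_eq[OF assms(1,2)])
qed

section \<open>Real-rootedness\<close>

text \<open>Dividing by \<open>(1 + t) ^ K\<close> removes the factor \<open>1 + t\<close> from
  \<open>gpart_Suc\<close>. The extra \<open>1 + t\<close> on \<open>cpart\<close> makes the
  remaining coefficient exactly \<open>t / (1 + t)\<^sup>2\<close>.\<close>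

lemma gamma_recursion_parts:
  assumes t: "t \<noteq> 1" "t \<noteq> - 1"
  shows "gamma_recursion (t / (1 + t)\<^sup>2)
    (\<lambda>K j. gpart t K j / (1 + t) ^ K) (\<lambda>K j. cpart t K j * (1 + t) / (1 + t) ^ K)"
proof
  have t1: "1 + t \<noteq> 0" using t by (metis add_eq_0_iff)
  have split: "(u * a + t * b) / u ^ Suc K = a / u ^ K + t / u\<^sup>2 * (b * u / u ^ K)"
    if "u \<noteq> 0" for u a b :: complex and K
    using that by (simp add: field_simps power2_eq_square)
  show "gpart t 0 0 / (1 + t) ^ 0 = 1" "cpart t 0 0 * (1 + t) / (1 + t) ^ 0 = 0"
    using t by (simp_all add: gpart_def cpart_def qder_def qint_Suc derange_0)
  fix K j :: nat assume j: "j \<le> Suc K"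
  show "cpart t (Suc K) j * (1 + t) / (1 + t) ^ Suc K = (\<Sum>i=j..<Suc K. gpart t K i / (1 + t) ^ K)"
    using t1 by (simp add: cpart_Suc[OF j] sum_divide_distrib[symmetric] del: sum.op_ivl_Suc)
  show "gpart t (Suc K) j / (1 + t) ^ Suc K = (\<Sum>i=j..<Suc K. gpart t K i / (1 + t) ^ K) +
      t / (1 + t)\<^sup>2 * (\<Sum>i=0..<j. cpart t K i * (1 + t) / (1 + t) ^ K)"
    unfolding gpart_Suc[OF t(1) j] sum_divide_distrib[symmetric] sum_distrib_right[symmetric]
    by (rule split[OF t1])
qed

text \<open>Up to a positive factor the imaginary part is
  \<open>Im t * (1 - (norm t)\<^sup>2)\<close>, so \<open>t\<close> lies on the unit circle. There
  the real part is a positive multiple of \<open>2 + 2 * Re t\<close>.\<close>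

lemma gamma_substitution_real:
  fixes t :: complex
  assumes "t \<notin> \<real>" "Im (t / (1 + t)\<^sup>2) = 0"
  shows "0 \<le> Re (t / (1 + t)\<^sup>2)"
proof -
  define c where "c = (norm ((1 + t)\<^sup>2))\<^sup>2"
  have t1: "1 + t \<noteq> 0" using assms(1) by (metis Reals_1 Reals_minus add_eq_0_iff)
  then have c: "0 < c" by (simp add: c_def)
  have "t * cnj ((1 + t)\<^sup>2) = t + 2 * (t * cnj t) + (t * cnj t) * cnj t"
    by (simp add: power2_eq_square algebra_simps)
  also have "\<dots> = t + of_real (2 * (norm t)\<^sup>2) + of_real ((norm t)\<^sup>2) * cnj t"
    unfolding complex_norm_square[symmetric] by simp
  finally have eq: "t / (1 + t)\<^sup>2 =
      (t + of_real (2 * (norm t)\<^sup>2) + of_real ((norm t)\<^sup>2) * cnj t) / of_real c"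
    using complex_div_cnj[of t "(1 + t)\<^sup>2"] by (simp add: c_def)
  have "Im t * (1 - (norm t)\<^sup>2) = 0"
    using assms(2) c unfolding eq
    by (simp add: algebra_simps del: of_real_power of_real_mult of_real_add)
  then have n: "(norm t)\<^sup>2 = 1" using assms(1) complex_is_Real_iff by auto
  then have "norm t = 1" by (metis norm_ge_zero one_power2 power2_eq_iff_nonneg zero_le_one)
  then have "\<bar>Re t\<bar> \<le> 1" using abs_Re_le_cmod[of t] by simp
  then show ?thesis
    using c unfolding eq n by (simp add: zero_le_divide_iff)
qed

lemma uchow_nonzero:
  assumes t: "t \<notin> \<real>" "0 \<le> Im (t / (1 + t)\<^sup>2)" and k: "1 \<le> k" "k \<le> n"
  shows "uchow t k n \<noteq> 0"
proof -
  obtain K where K: "k = Suc K" using k by (cases k) auto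
  have t': "t \<noteq> 1" "t \<noteq> - 1" using t by auto
  have t1: "1 + t \<noteq> 0" using t' by (metis add_eq_0_iff)
  interpret gamma_recursion "t / (1 + t)\<^sup>2"
    "\<lambda>K j. gpart t K j / (1 + t) ^ K" "\<lambda>K j. cpart t K j * (1 + t) / (1 + t) ^ K"
    by (rule gamma_recursion_parts[OF t'])
  define w where "w j = real (n - Suc K + j choose j)" for j
  have w: "0 < w 0" "\<And>j. 0 \<le> w j" by (auto simp: w_def)
  have "(\<Sum>j=0..<Suc K. of_real (w j) * (gpart t K j / (1 + t) ^ K)) \<noteq> 0"
  proof (cases "Im (t / (1 + t)\<^sup>2) = 0")
    case True
    then have "t / (1 + t)\<^sup>2 = of_real (Re (t / (1 + t)\<^sup>2))"
      by (simp add: complex_eq_iff)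
    from weighted_sum_nonzero_real[of _ w, OF this gamma_substitution_real[OF t(1) True] w]
    show ?thesis .
  next
    case False
    then show ?thesis using t(2) by (intro weighted_sum_nonzero_upper w) auto
  qed
  moreover have "(\<Sum>j=0..<Suc K. of_real (w j) * (gpart t K j / (1 + t) ^ K)) =
      uchow t k n / (1 + t) ^ K"
    unfolding K uchow_gpart[OF k(2)[unfolded K]] sum_divide_distrib
    by (simp add: w_def atLeast0LessThan lessThan_Suc_atMost del: sum.op_ivl_Suc)
  ultimately show ?thesis by auto
qed

theorem theorem1p1:
  fixes k n :: nat and z :: complex
  assumes "1 \<le> k" and "k \<le> n"
    and "poly (map_poly of_int (chow_poly (uniform_lattice k n))) z = 0"
  shows "z \<in> \<real>"
proof (rule ccontr)
  assume z: "z \<notin> \<real>"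
  have *: "ipoly (chow_poly (uniform_lattice k n)) t \<noteq> 0"
    if "t \<notin> \<real>" "0 \<le> Im (t / (1 + t)\<^sup>2)" for t
  proof -
    have "t \<noteq> 1" using that by auto
    then show ?thesis
      using ipoly_chow_uniform uchow_nonzero that assms(1,2) by simp
  qed
  show False
  proof (cases "0 \<le> Im (z / (1 + z)\<^sup>2)")
    case True
    then show ?thesis using * z assms(3) by blast
  next
    \<comment> \<open>The coefficients are integers, so \<open>cnj z\<close> is a zero as well, and
      conjugation moves the substituted value to the upper half plane.\<close>
    case False
    have "cnj z / (1 + cnj z)\<^sup>2 = cnj (z / (1 + z)\<^sup>2)" by simp
    then have "0 \<le> Im (cnj z / (1 + cnj z)\<^sup>2)" using False by (simp only: cnj.sel)
    moreover have "cnj z \<notin> \<real>" using z by (simp add: complex_is_Real_iff)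
    ultimately have "ipoly (chow_poly (uniform_lattice k n)) (cnj z) \<noteq> 0" by (rule *[rotated])
    then show ?thesis using assms(3) by (simp add: ipoly_cnj)
  qed
qed

end
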